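(* The following conjecture of Voss is false: for each integer $k\ge 4$, $g_k(n)\to\infty$ as $n\to\infty$, where $g_k(n)$ denotes the largest integer $\alpha$ such that every $n$-vertex $k$-critical graph contains an odd cycle with at least $\alpha$ chords.
   Context: All graphs are finite and simple. A graph $G$ is $k$-critical if its chromatic number is $\chi(G)=k$ and every proper subgraph of $G$ is $(k-1)$-colorable. An odd cycle is a cycle of odd length. A chord of a cycle $C$ in $G$ is an edge of $G$ joining two vertices of $C$ that are not consecutive on $C$. *)

theory Defs
  imports Complex_Main "HOL-Library.Extended_Real"
begin

text \<open>A finite simple graph is given by its vertex set \<open>V\<close> and its edge set \<open>E\<close>,
  whose members are two-element subsets of \<open>V\<close>.\<close>

definition simple_graph :: "'a set \<Rightarrow> 'a set set \<Rightarrow> bool" where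
  "simple_graph V E \<longleftrightarrow> finite V \<and> (\<forall>e\<in>E. e \<subseteq> V \<and> card e = 2)"

definition proper_subgraph :: "'a set \<Rightarrow> 'a set set \<Rightarrow> 'a set \<Rightarrow> 'a set set \<Rightarrow> bool" where
  "proper_subgraph V' E' V E \<longleftrightarrow>
     simple_graph V' E' \<and> V' \<subseteq> V \<and> E' \<subseteq> E \<and> (V', E') \<noteq> (V, E)"

definition colorable :: "'a set \<Rightarrow> 'a set set \<Rightarrow> nat \<Rightarrow> bool" where
  "colorable V E k \<longleftrightarrow>
     (\<exists>c :: 'a \<Rightarrow> nat. (\<forall>v\<in>V. c v < k) \<and> (\<forall>u v. {u, v} \<in> E \<longrightarrow> c u \<noteq> c v))"

definition chromatic_number :: "'a set \<Rightarrow> 'a set set \<Rightarrow> nat" where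
  "chromatic_number V E = (LEAST k. colorable V E k)"

definition critical :: "nat \<Rightarrow> 'a set \<Rightarrow> 'a set set \<Rightarrow> bool" where
  "critical k V E \<longleftrightarrow> simple_graph V E \<and> chromatic_number V E = k \<and>
     (\<forall>V' E'. proper_subgraph V' E' V E \<longrightarrow> colorable V' E' (k - 1))"

text \<open>A cycle is given by the list of its vertices in cyclic order.\<close>

definition cycle_edges :: "'a list \<Rightarrow> 'a set set" where
  "cycle_edges vs = {{vs ! i, vs ! (Suc i mod length vs)} | i. i < length vs}"

definition is_cycle :: "'a set \<Rightarrow> 'a set set \<Rightarrow> 'a list \<Rightarrow> bool" where
  "is_cycle V E vs \<longleftrightarrow>
     3 \<le> length vs \<and> distinct vs \<and> set vs \<subseteq> V \<and> cycle_edges vs \<subseteq> E"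

definition chords :: "'a set set \<Rightarrow> 'a list \<Rightarrow> 'a set set" where
  "chords E vs = {e \<in> E. e \<subseteq> set vs \<and> e \<notin> cycle_edges vs}"

text \<open>The vertices are taken from \<open>nat\<close>, which loses nothing: every finite graph is isomorphic
  to one on natural numbers.\<close>

definition all_critical_have :: "nat \<Rightarrow> nat \<Rightarrow> nat \<Rightarrow> bool" where
  "all_critical_have k n a \<longleftrightarrow>
     (\<forall>(V :: nat set) E. critical k V E \<and> card V = n \<longrightarrow>
        (\<exists>vs. is_cycle V E vs \<and> odd (length vs) \<and> a \<le> card (chords E vs)))"

text \<open>The largest \<open>a\<close> with the above property. The supremum is taken in \<open>enat\<close> because for
  some \<open>n\<close> (for example \<open>n = k + 1\<close>) there is no \<open>k\<close>-critical graph on \<open>n\<close> vertices, so that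
  every \<open>a\<close> qualifies and the value is \<open>\<infinity>\<close>. Otherwise the supremum is a maximum, as
  shown below.\<close>

definition g :: "nat \<Rightarrow> nat \<Rightarrow> enat" where
  "g k n = (SUP a \<in> {a. all_critical_have k n a}. enat a)"

lemma g_is_greatest:
  fixes V :: "nat set"
  assumes graph: "critical k V E" "card V = n"
    and odd_cycle: "all_critical_have k n 0"
  obtains a where "g k n = enat a" "all_critical_have k n a"
    "\<And>b. all_critical_have k n b \<Longrightarrow> b \<le> a"
proof -
  let ?S = "{a. all_critical_have k n a}"
  have "E \<subseteq> Pow V" "finite V"
    using graph unfolding critical_def simple_graph_def by auto
  then have fin: "finite E"
    by (meson finite_Pow_iff finite_subset)
  have "a \<le> card E" if a: "a \<in> ?S" for a
  proof -
    obtain vs where "a \<le> card (chords E vs)"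
      using a graph unfolding all_critical_have_def by blast
    also have "\<dots> \<le> card E"
      using fin by (intro card_mono) (auto simp: chords_def)
    finally show ?thesis .
  qed
  then have finS: "finite ?S"
    by (meson finite_nat_set_iff_bounded_le)
  have ne: "?S \<noteq> {}"
    using odd_cycle by auto
  have max: "Max ?S \<in> ?S" "\<And>b. b \<in> ?S \<Longrightarrow> b \<le> Max ?S"
    using finS ne by (auto intro: Max_in[of ?S, simplified])
  have "g k n = enat (Max ?S)"
    unfolding g_def
  proof (rule antisym)
    show "(SUP a \<in> ?S. enat a) \<le> enat (Max ?S)"
      using max(2) by (intro SUP_least) simp
    show "enat (Max ?S) \<le> (SUP a \<in> ?S. enat a)"
      by (rule SUP_upper[OF max(1)])
  qed
  then show thesis
    using max that[of "Max ?S"] by auto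
qed

end

theory Submission
  imports Defs
begin

text \<open>Take an odd wheel and replace each spoke by a diamond (\<open>K\<^sub>4\<close> minus an edge) hanging at its
  rim vertex, whose other tip is joined to the hub. In a 3-colouring the two tips of a diamond get
  the same colour, so the diamond acts like the spoke and the graph is 4-critical, but a rim vertex
  and the hub are no longer adjacent. A cycle meets the interior of at most two diamonds, since it
  can only leave the interior through the rim vertex and through an edge at the hub. All its
  chords lie in these diamonds and the hub.\<close>

section \<open>Colourings and critical graphs\<close>

lemma colorable_mono:
  assumes "colorable V E k" "k \<le> l"
  shows "colorable V E l"
  using assms unfolding colorable_def by (meson less_le_trans)

text \<open>One end of the restored edge receives the fresh colour \<open>k\<close>, which clashes
  with nothing.\<close>

lemma colorable_insert_edge:
  assumes G: "simple_graph V E" and e: "e \<in> E" and col: "colorable V (E - {e}) k"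
  shows "colorable V E (Suc k)"
proof -
  obtain c :: "'a \<Rightarrow> nat" where c: "\<forall>v\<in>V. c v < k" "\<forall>u v. {u, v} \<in> E - {e} \<longrightarrow> c u \<noteq> c v"
    using col unfolding colorable_def by blast
  obtain x y where xy: "e = {x, y}" "x \<noteq> y"
    using G e unfolding simple_graph_def by (meson card_2_iff)
  have ends: "u \<in> V" "v \<in> V" "u \<noteq> v" if "{u, v} \<in> E" for u v
    using that G unfolding simple_graph_def by (auto simp: card_insert_if split: if_splits)
  have "(c(x := k)) u \<noteq> (c(x := k)) v" if "{u, v} \<in> E" for u v
    using ends[OF that] c that xy by (cases "{u, v} = e") (auto simp: doubleton_eq_iff)
  moreover have "(c(x := k)) v < Suc k" if "v \<in> V" for v
    using c(1) that by (auto simp: less_SucI)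
  ultimately show ?thesis
    unfolding colorable_def by blast
qed

text \<open>If no vertex is isolated, the edge set determines the vertex set, so a proper subgraph
  misses some edge. Hence only single edge deletions have to be tested, and any one of them also
  bounds the chromatic number from above.\<close>

lemma criticalI:
  assumes G: "simple_graph V E" and no_isolated: "V \<subseteq> \<Union> E" and "E \<noteq> {}"
    and not_col: "\<not> colorable V E k"
    and col: "\<And>e. e \<in> E \<Longrightarrow> colorable V (E - {e}) k"
  shows "critical (Suc k) V E"
proof -
  obtain e where "e \<in> E" using \<open>E \<noteq> {}\<close> by blast
  then have "colorable V E (Suc k)"
    using colorable_insert_edge[OF G] col by blast
  then have "chromatic_number V E = Suc k"
    unfolding chromatic_number_def using not_col colorable_mono
    by (intro Least_equality) (auto simp: not_less_eq_eq[symmetric])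
  moreover have "colorable V' E' k" if sub: "proper_subgraph V' E' V E" for V' E'
  proof -
    have *: "V' \<subseteq> V" "E' \<subseteq> E" "\<Union> E' \<subseteq> V'" "(V', E') \<noteq> (V, E)"
      using sub unfolding proper_subgraph_def simple_graph_def by auto
    then have "E' \<noteq> E"
      using no_isolated by blast
    then obtain e where "e \<in> E" "E' \<subseteq> E - {e}"
      using * by blast
    then show ?thesis
      using col[of e] * unfolding colorable_def by (meson subsetD)
  qed
  ultimately show ?thesis
    using G unfolding critical_def by simp
qed

section \<open>Cycles\<close>

lemma cycle_edge_neighbours:
  assumes "distinct vs" "i < length vs" "{vs ! i, v} \<in> cycle_edges vs"
  shows "v \<in> {vs ! (Suc i mod length vs), vs ! ((i + length vs - 1) mod length vs)}"
proof -
  let ?n = "length vs"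
  obtain j where j: "j < ?n" "{vs ! i, v} = {vs ! j, vs ! (Suc j mod ?n)}"
    using assms unfolding cycle_edges_def by auto
  have "Suc j mod ?n < ?n"
    using j by (intro mod_less_divisor) auto
  then consider "i = j" "v = vs ! (Suc j mod ?n)" | "i = Suc j mod ?n" "v = vs ! j"
    using j assms by (auto simp: doubleton_eq_iff nth_eq_iff_index_eq)
  then show ?thesis
  proof cases
    case 2
    have "(i + ?n - 1) mod ?n = j"
    proof (cases "Suc j = ?n")
      case False
      then have "i = Suc j" using 2 j by simp
      then show ?thesis using j by simp
    qed (use 2 j in auto)
    then show ?thesis using 2 by simp
  qed simp
qed

text \<open>Applied to the hub, this limits how many diamonds a cycle can enter.\<close>

lemma card_cycle_edge_neighbours:
  assumes "distinct vs"
  shows "finite {v. {u, v} \<in> cycle_edges vs}" "card {v. {u, v} \<in> cycle_edges vs} \<le> 2"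
proof -
  have "\<exists>a b. {v. {u, v} \<in> cycle_edges vs} \<subseteq> {a, b}"
  proof (cases "u \<in> set vs")
    case True
    then obtain i where "i < length vs" "u = vs ! i"
      by (metis in_set_conv_nth)
    then show ?thesis
      using cycle_edge_neighbours[OF assms] by blast
  next
    case False
    have "vs ! (Suc i mod length vs) \<in> set vs" if "i < length vs" for i
      using that by (intro nth_mem mod_less_divisor) auto
    then have "{v. {u, v} \<in> cycle_edges vs} = {}"
      using False unfolding cycle_edges_def by (auto simp: doubleton_eq_iff)
    then show ?thesis by simp
  qed
  then obtain a b where sub: "{v. {u, v} \<in> cycle_edges vs} \<subseteq> {a, b}" by blast
  then show "finite {v. {u, v} \<in> cycle_edges vs}"
    by (rule finite_subset) simp
  have "card {v. {u, v} \<in> cycle_edges vs} \<le> card {a, b}"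
    using sub by (intro card_mono) auto
  also have "\<dots> \<le> 2"
    by (simp add: card_insert_if)
  finally show "card {v. {u, v} \<in> cycle_edges vs} \<le> 2" .
qed

lemma cycle_neighbours_exist:
  assumes "3 \<le> length vs" "distinct vs" "u \<in> set vs"
  obtains v w where "v \<noteq> w" "v \<in> set vs" "w \<in> set vs"
    "{u, v} \<in> cycle_edges vs" "{u, w} \<in> cycle_edges vs"
proof -
  let ?n = "length vs"
  obtain i where i: "i < ?n" "u = vs ! i"
    using assms by (metis in_set_conv_nth)
  define p where "p = (if i = 0 then ?n - 1 else i - 1)"
  define s where "s = Suc i mod ?n"
  have p: "p < ?n" "Suc p mod ?n = i"
    using i assms unfolding p_def by auto
  \<comment> \<open>Length at least 3 keeps predecessor and successor apart.\<close>
  have s: "s < ?n" "s \<noteq> p"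
    using i assms unfolding p_def s_def
    by (auto simp: mod_Suc)
  have "{u, vs ! s} \<in> cycle_edges vs"
    using i unfolding s_def cycle_edges_def by blast
  moreover have "{vs ! p, vs ! (Suc p mod ?n)} \<in> cycle_edges vs"
    using p(1) unfolding cycle_edges_def by blast
  then have "{u, vs ! p} \<in> cycle_edges vs"
    using p(2) i by (simp add: insert_commute)
  moreover have "vs ! s \<noteq> vs ! p"
    using s p assms by (simp add: nth_eq_iff_index_eq)
  ultimately show thesis
    using that p s by simp
qed

text \<open>Removing \<open>x\<close> from a cycle leaves a connected graph, so a set closed under
  the remaining cycle edges contains all of it once it meets it.\<close>

lemma cycle_minus_vertex_connected:
  assumes closed: "\<And>a b. {a, b} \<in> cycle_edges vs \<Longrightarrow> a \<noteq> x \<Longrightarrow> b \<noteq> x \<Longrightarrow> a \<in> A \<Longrightarrow> b \<in> A"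
    and "distinct vs" and meets: "a \<in> set vs" "a \<in> A" "a \<noteq> x"
  shows "set vs \<subseteq> insert x A"
proof -
  let ?n = "length vs"
  \<comment> \<open>Rotating by \<open>k\<close> puts \<open>x\<close> at position 0 if it lies on
    the cycle; otherwise any \<open>k\<close> will do. The positions from \<open>s\<close> on, with
    \<open>s\<close> defined below, then form a path that avoids \<open>x\<close>.\<close>
  obtain k where k: "k < ?n" "x \<in> set vs \<Longrightarrow> vs ! k = x"
    using meets by (metis in_set_conv_nth)
  define ws where "ws = rotate k vs"
  have ws: "set ws = set vs" "length ws = ?n" "distinct ws"
    using \<open>distinct vs\<close> unfolding ws_def by simp_all
  have edge: "{ws ! j, ws ! Suc j} \<in> cycle_edges vs" if "Suc j < ?n" for j
  proof -
    have "{vs ! i, vs ! (Suc i mod ?n)} \<in> cycle_edges vs" if "i < ?n" for i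
      using that unfolding cycle_edges_def by blast
    moreover have "(k + j) mod ?n < ?n"
      using k by (intro mod_less_divisor) linarith
    ultimately have "{vs ! ((k + j) mod ?n), vs ! (Suc (k + j) mod ?n)} \<in> cycle_edges vs"
      by (metis mod_Suc_eq)
    then show ?thesis
      using that unfolding ws_def by (simp add: nth_rotate)
  qed
  define s :: nat where "s = (if x \<in> set vs then 1 else 0)"
  have first: "ws ! 0 = x" if "x \<in> set vs"
    using k that nth_rotate[of 0 vs k] unfolding ws_def by fastforce
  have avoid: "ws ! j \<noteq> x" if "s \<le> j" "j < ?n" for j
  proof (cases "x \<in> set vs")
    case True
    then have "0 < j" "0 < ?n" using that unfolding s_def by auto
    then show ?thesis
      using that ws first True nth_eq_iff_index_eq[of ws j 0] by auto
  next
    case False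
    then show ?thesis using that ws nth_mem[of j ws] by auto
  qed
  have index: "\<exists>j. s \<le> j \<and> j < ?n \<and> v = ws ! j" if v: "v \<in> set vs" "v \<noteq> x" for v
  proof -
    obtain j where j: "j < ?n" "v = ws ! j"
      using v ws by (metis in_set_conv_nth)
    then have "s \<le> j"
      using v first unfolding s_def by (cases j) auto
    then show ?thesis using j by blast
  qed
  have walk: "ws ! i \<in> A \<longleftrightarrow> ws ! j \<in> A" if "i \<le> j" "s \<le> i" "j < ?n" for i j
    using that
  proof (induction j rule: dec_induct)
    case (step j)
    then have "{ws ! j, ws ! Suc j} \<in> cycle_edges vs" "ws ! j \<noteq> x" "ws ! Suc j \<noteq> x"
      using edge avoid by simp_all
    then have "ws ! j \<in> A \<longleftrightarrow> ws ! Suc j \<in> A"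
      using closed[of "ws ! j" "ws ! Suc j"] closed[of "ws ! Suc j" "ws ! j"]
      by (auto simp: insert_commute)
    then show ?case using step by simp
  qed simp
  obtain i where i: "s \<le> i" "i < ?n" "ws ! i \<in> A"
    using index meets by metis
  have "v \<in> A" if "v \<in> set vs" "v \<noteq> x" for v
    using index[OF that] walk[of i] walk[of _ i] i by (metis nle_le)
  then show ?thesis by blast
qed

section \<open>Wheels with diamonds for spokes\<close>

text \<open>After the hub, each diamond occupies a block of four consecutive numbers, so the
  vertices fill an initial segment of \<open>nat\<close>. The tips of the diamond are
  \<open>rim i\<close> and \<open>tip i\<close>; the wings are its two vertices of degree 3.\<close>

definition hub :: nat where "hub = 0"
definition rim :: "nat \<Rightarrow> nat" where "rim i = 4 * i + 1"
definition wing1 :: "nat \<Rightarrow> nat" where "wing1 i = 4 * i + 2"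
definition wing2 :: "nat \<Rightarrow> nat" where "wing2 i = 4 * i + 3"
definition tip :: "nat \<Rightarrow> nat" where "tip i = 4 * i + 4"

lemmas vertex_defs = hub_def rim_def wing1_def wing2_def tip_def

lemma vertex_eq_simps [simp]:
  "rim i = rim j \<longleftrightarrow> i = j" "wing1 i = wing1 j \<longleftrightarrow> i = j"
  "wing2 i = wing2 j \<longleftrightarrow> i = j" "tip i = tip j \<longleftrightarrow> i = j"
  "hub \<noteq> rim i" "hub \<noteq> wing1 i" "hub \<noteq> wing2 i" "hub \<noteq> tip i"
  "rim i \<noteq> hub" "wing1 i \<noteq> hub" "wing2 i \<noteq> hub" "tip i \<noteq> hub"
  "rim i \<noteq> wing1 j" "rim i \<noteq> wing2 j" "rim i \<noteq> tip j"
  "wing1 i \<noteq> rim j" "wing1 i \<noteq> wing2 j" "wing1 i \<noteq> tip j"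
  "wing2 i \<noteq> rim j" "wing2 i \<noteq> wing1 j" "wing2 i \<noteq> tip j"
  "tip i \<noteq> rim j" "tip i \<noteq> wing1 j" "tip i \<noteq> wing2 j"
  unfolding vertex_defs by presburger+

definition wheel_vertices :: "nat \<Rightarrow> nat set" where
  "wheel_vertices m = {..4 * m}"

definition wheel_edges :: "nat \<Rightarrow> nat set set" where
  "wheel_edges m = (\<Union>i<m. {{rim i, rim (Suc i mod m)}, {rim i, wing1 i}, {rim i, wing2 i},
     {wing1 i, wing2 i}, {wing1 i, tip i}, {wing2 i, tip i}, {tip i, hub}})"

lemma card_wheel_vertices: "card (wheel_vertices m) = 4 * m + 1"
  by (simp add: wheel_vertices_def)

lemma wheel_vertices_eq:
  "wheel_vertices m = insert hub (\<Union>i<m. {rim i, wing1 i, wing2 i, tip i})"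
proof -
  have "v \<in> insert hub (\<Union>i<m. {rim i, wing1 i, wing2 i, tip i})" if "v \<le> 4 * m" for v
  proof (cases "v = 0")
    case False
    define i d where "i = (v - 1) div 4" and "d = (v - 1) mod 4"
    have "4 * i + d = v - 1" "d < 4"
      unfolding i_def d_def by simp_all
    then have "i < m" "v = 4 * i + d + 1"
      using that False by linarith+
    moreover have "d = 0 \<or> d = 1 \<or> d = 2 \<or> d = 3"
      using \<open>d < 4\<close> by linarith
    ultimately have "v = rim i \<or> v = wing1 i \<or> v = wing2 i \<or> v = tip i"
      unfolding vertex_defs by auto
    then show ?thesis using \<open>i < m\<close> by blast
  qed (simp add: hub_def)
  moreover have "insert hub (\<Union>i<m. {rim i, wing1 i, wing2 i, tip i}) \<subseteq> {..4 * m}"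
    by (auto simp: vertex_defs)
  ultimately show ?thesis
    unfolding wheel_vertices_def by blast
qed

lemma wheel_edgesI:
  assumes "i < m"
  shows "{rim i, rim (Suc i mod m)} \<in> wheel_edges m" "{rim i, wing1 i} \<in> wheel_edges m"
    "{rim i, wing2 i} \<in> wheel_edges m" "{wing1 i, wing2 i} \<in> wheel_edges m"
    "{wing1 i, tip i} \<in> wheel_edges m" "{wing2 i, tip i} \<in> wheel_edges m"
    "{tip i, hub} \<in> wheel_edges m"
  unfolding wheel_edges_def by (rule UN_I[of i]; simp add: assms)+

lemma wheel_edge_cases:
  assumes "e \<in> wheel_edges m"
  obtains i where "i < m" "e = {rim i, rim (Suc i mod m)}"
  | i where "i < m" "e = {rim i, wing1 i}"
  | i where "i < m" "e = {rim i, wing2 i}"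
  | i where "i < m" "e = {wing1 i, wing2 i}"
  | i where "i < m" "e = {wing1 i, tip i}"
  | i where "i < m" "e = {wing2 i, tip i}"
  | i where "i < m" "e = {tip i, hub}"
  using assms unfolding wheel_edges_def by (elim UN_E insertE emptyE) simp_all

lemma simple_graph_wheel:
  assumes "2 \<le> m"
  shows "simple_graph (wheel_vertices m) (wheel_edges m)"
proof -
  \<comment> \<open>With \<open>m\<close> at least 2 no rim edge degenerates to a loop.\<close>
  have succ: "i \<noteq> Suc i mod m" "Suc i mod m < m" if "i < m" for i
    using that assms by (auto simp: mod_Suc)
  have "e \<subseteq> wheel_vertices m \<and> card e = 2" if "e \<in> wheel_edges m" for e
    using that succ by (cases rule: wheel_edge_cases) (auto simp: wheel_vertices_eq)
  then show ?thesis
    unfolding simple_graph_def by (simp add: wheel_vertices_def)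
qed

section \<open>4-criticality of the wheels with diamonds\<close>

lemma not_colorable_wheel:
  assumes "odd m"
  shows "\<not> colorable (wheel_vertices m) (wheel_edges m) 3"
proof
  assume "colorable (wheel_vertices m) (wheel_edges m) 3"
  then obtain c :: "nat \<Rightarrow> nat" where less3: "\<And>v. v \<in> wheel_vertices m \<Longrightarrow> c v < 3"
    and proper: "\<And>u v. {u, v} \<in> wheel_edges m \<Longrightarrow> c u \<noteq> c v"
    unfolding colorable_def by blast
  have less3': "c hub < 3" "i < m \<Longrightarrow> c (rim i) < 3" "i < m \<Longrightarrow> c (wing1 i) < 3"
    "i < m \<Longrightarrow> c (wing2 i) < 3" "i < m \<Longrightarrow> c (tip i) < 3" for i
    using less3 unfolding wheel_vertices_eq by auto
  \<comment> \<open>The wings use up the two colours different from that of \<open>rim i\<close>, so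
    \<open>tip i\<close> must repeat the colour of \<open>rim i\<close>, and \<open>tip i\<close> is
    adjacent to the hub.\<close>
  have spoke: "c (rim i) \<noteq> c hub" if "i < m" for i
  proof -
    have "c (rim i) \<noteq> c (wing1 i)" "c (rim i) \<noteq> c (wing2 i)" "c (wing1 i) \<noteq> c (wing2 i)"
      "c (wing1 i) \<noteq> c (tip i)" "c (wing2 i) \<noteq> c (tip i)" "c (tip i) \<noteq> c hub"
      by (intro proper wheel_edgesI that)+
    then show ?thesis using less3'(1) less3'(2-5)[OF that] by linarith
  qed
  have adj: "c (rim i) \<noteq> c (rim (Suc i mod m))" if "i < m" for i
    by (intro proper wheel_edgesI that)
  \<comment> \<open>Only two colours are left for the rim, so they alternate. Since
    \<open>m - 1\<close> is even, the edge closing the rim then has equal ends.\<close>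
  have alternate: "c (rim i) = c (rim 0) \<longleftrightarrow> even i" if "i < m" for i
    using that
  proof (induction i)
    case (Suc i)
    then have "c (rim i) \<noteq> c (rim (Suc i))" using adj[of i] by simp
    then show ?case
      using Suc spoke[of i] spoke[of "Suc i"] spoke[of 0] less3'(2)[of i] less3'(2)[of "Suc i"]
        less3'(2)[of 0] less3'(1)
      by simp linarith
  qed simp
  have "0 < m" using assms by (rule odd_pos)
  then have "c (rim (m - 1)) \<noteq> c (rim 0)" using adj[of "m - 1"] by simp
  then show False using alternate[of "m - 1"] assms \<open>0 < m\<close> by simp
qed

text \<open>A colouring is given by one function per vertex type, with the hub coloured 0. Each type
  of edge yields one condition, guarded by membership in \<open>E'\<close> so that a deleted edge
  imposes nothing.\<close>

lemma colorable_subwheelI: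
  fixes r a b t :: "nat \<Rightarrow> nat"
  assumes sub: "E' \<subseteq> wheel_edges m"
    and less3: "\<And>i. i < m \<Longrightarrow> r i < 3 \<and> a i < 3 \<and> b i < 3 \<and> t i < 3"
    and proper: "\<And>i. i < m \<Longrightarrow> {rim i, rim (Suc i mod m)} \<in> E' \<Longrightarrow> r i \<noteq> r (Suc i mod m)"
      "\<And>i. i < m \<Longrightarrow> {rim i, wing1 i} \<in> E' \<Longrightarrow> r i \<noteq> a i"
      "\<And>i. i < m \<Longrightarrow> {rim i, wing2 i} \<in> E' \<Longrightarrow> r i \<noteq> b i"
      "\<And>i. i < m \<Longrightarrow> {wing1 i, wing2 i} \<in> E' \<Longrightarrow> a i \<noteq> b i"
      "\<And>i. i < m \<Longrightarrow> {wing1 i, tip i} \<in> E' \<Longrightarrow> a i \<noteq> t i"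
      "\<And>i. i < m \<Longrightarrow> {wing2 i, tip i} \<in> E' \<Longrightarrow> b i \<noteq> t i"
      "\<And>i. i < m \<Longrightarrow> {tip i, hub} \<in> E' \<Longrightarrow> t i \<noteq> 0"
  shows "colorable (wheel_vertices m) E' 3"
proof -
  define c :: "nat \<Rightarrow> nat" where "c v = (if v = 0 then 0 else
    let i = (v - 1) div 4; d = (v - 1) mod 4 in
      if d = 0 then r i else if d = 1 then a i else if d = 2 then b i else t i)" for v
  have "c (4 * i + (d + 1)) = (if d = 0 then r i else if d = 1 then a i else if d = 2 then b i else t i)"
    if "d < 4" for i d
  proof -
    have "(4 * i + d) div 4 = i" "(4 * i + d) mod 4 = d" using that by presburger+
    then show ?thesis unfolding c_def by (simp add: Let_def)
  qed
  from this[of 0] this[of 1] this[of 2] this[of 3]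
  have c: "c hub = 0" "c (rim i) = r i" "c (wing1 i) = a i" "c (wing2 i) = b i" "c (tip i) = t i" for i
    unfolding vertex_defs by (simp_all add: c_def[of 0])
  have "c v < 3" if "v \<in> wheel_vertices m" for v
    using that less3 unfolding wheel_vertices_eq by (auto simp: c)
  moreover have "\<exists>x y. e = {x, y} \<and> c x \<noteq> c y" if e: "e \<in> E'" for e
  proof -
    have "e \<in> wheel_edges m" using e sub by blast
    then show ?thesis
      by (cases rule: wheel_edge_cases)
        (intro exI conjI, assumption, use e proper in \<open>simp add: c\<close>)+
  qed
  then have "c u \<noteq> c v" if "{u, v} \<in> E'" for u v
    using that by (metis doubleton_eq_iff)
  ultimately show ?thesis
    unfolding colorable_def by blast
qed

text \<open>With \<open>m\<close> odd, these colours alternate along the rim, except across the rim edge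
  from \<open>j\<close> to its successor.\<close>

definition rim_color :: "nat \<Rightarrow> nat \<Rightarrow> nat" where
  "rim_color j i = 1 + (if i \<le> j then i + j else i + j + 1) mod 2"

lemma rim_color_simps [simp]:
  "0 < rim_color j i" "rim_color j i < 3" "3 - rim_color j i < 3"
  "\<not> 3 \<le> rim_color j i" "rim_color j i \<noteq> 3 - rim_color j i" "3 - rim_color j i \<noteq> rim_color j i"
proof -
  have "n mod 2 = 0 \<or> n mod 2 = 1" for n :: nat by auto
  then have "rim_color j i = 1 \<or> rim_color j i = 2"
    unfolding rim_color_def by simp
  then show "0 < rim_color j i" "rim_color j i < 3" "3 - rim_color j i < 3"
    "\<not> 3 \<le> rim_color j i" "rim_color j i \<noteq> 3 - rim_color j i" "3 - rim_color j i \<noteq> rim_color j i"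
    by auto
qed

lemma rim_color_alternates:
  assumes "odd m" "i < m" "j < m" "i \<noteq> j"
  shows "rim_color j i \<noteq> rim_color j (Suc i mod m)"
proof (cases "Suc i = m")
  case True
  \<comment> \<open>Here the successor is 0, on the other side of the shift at \<open>j\<close>: the
    parities to compare are those of \<open>m + j\<close> and \<open>j\<close>, which differ because
    \<open>m\<close> is odd.\<close>
  then have "\<not> i \<le> j" "even i" using assms by auto
  then show ?thesis using True \<open>odd m\<close> unfolding rim_color_def by simp presburger
next
  case False
  then have "Suc i mod m = Suc i" using assms by simp
  moreover have "i \<le> j \<longleftrightarrow> Suc i \<le> j" using assms by auto
  moreover have "n mod 2 \<noteq> Suc n mod 2" "Suc n mod 2 \<noteq> n mod 2" for n :: nat
    by presburger+
  ultimately show ?thesis unfolding rim_color_def by simp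
qed

text \<open>Rim and tip of each diamond share a colour from 1 and 2; the wings take 0 and the other
  nonzero colour \<open>3 - rim_color j i\<close>.\<close>

lemma colorable_wheel_minus_rim_edge:
  assumes "odd m" "j < m"
  shows "colorable (wheel_vertices m) (wheel_edges m - {{rim j, rim (Suc j mod m)}}) 3"
proof (rule colorable_subwheelI[where r = "rim_color j" and t = "rim_color j" and a = "\<lambda>_. 0"
      and b = "\<lambda>i. 3 - rim_color j i"])
  fix i assume "i < m"
    "{rim i, rim (Suc i mod m)} \<in> wheel_edges m - {{rim j, rim (Suc j mod m)}}"
  then show "rim_color j i \<noteq> rim_color j (Suc i mod m)"
    using rim_color_alternates assms by blast
qed simp_all

text \<open>Once an edge of the \<open>j\<close>-th spoke is missing, its rim vertex can share the colour 0 of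
  the hub.\<close>

lemma colorable_wheel_minus_spoke_edge:
  fixes a b t :: nat
  assumes "odd m" "2 \<le> m" "j < m"
    and less3: "a < 3" "b < 3" "t < 3"
    and e: "{rim j, wing1 j} \<noteq> e \<Longrightarrow> 0 < a" "{rim j, wing2 j} \<noteq> e \<Longrightarrow> 0 < b"
      "{wing1 j, wing2 j} \<noteq> e \<Longrightarrow> a \<noteq> b" "{wing1 j, tip j} \<noteq> e \<Longrightarrow> a \<noteq> t"
      "{wing2 j, tip j} \<noteq> e \<Longrightarrow> b \<noteq> t" "{tip j, hub} \<noteq> e \<Longrightarrow> 0 < t"
  shows "colorable (wheel_vertices m) (wheel_edges m - {e}) 3"
proof (rule colorable_subwheelI[where r = "(rim_color j)(j := 0)" and t = "(rim_color j)(j := t)"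
      and a = "(\<lambda>_. 0)(j := a)" and b = "(\<lambda>i. 3 - rim_color j i)(j := b)"])
  \<comment> \<open>The rim edges at \<open>j\<close> join colour 0 to a nonzero colour, including
    the one whose ends \<open>rim_color j\<close> does not separate; the other rim edges still
    alternate.\<close>
  fix i assume "i < m"
  moreover have "j \<noteq> Suc j mod m"
    using assms by (auto simp: mod_Suc)
  ultimately show "((rim_color j)(j := 0)) i \<noteq> ((rim_color j)(j := 0)) (Suc i mod m)"
    using rim_color_alternates[of m i j] assms by auto
qed (simp_all add: less3, (use e in blast)+)

lemma critical_wheel:
  assumes "odd m" "2 \<le> m"
  shows "critical 4 (wheel_vertices m) (wheel_edges m)"
proof -
  have "critical (Suc 3) (wheel_vertices m) (wheel_edges m)"
  proof (rule criticalI)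
    show "simple_graph (wheel_vertices m) (wheel_edges m)"
      using assms by (simp add: simple_graph_wheel)
    have "{hub, rim i, wing1 i, wing2 i, tip i} \<subseteq> \<Union> (wheel_edges m)" if "i < m" for i
      using wheel_edgesI[OF that] by blast
    moreover have "0 < m" using assms by simp
    ultimately show "wheel_vertices m \<subseteq> \<Union> (wheel_edges m)"
      unfolding wheel_vertices_eq by blast
    show "wheel_edges m \<noteq> {}"
      using wheel_edgesI(1)[of 0 m] assms by auto
    show "\<not> colorable (wheel_vertices m) (wheel_edges m) 3"
      using assms by (simp add: not_colorable_wheel)
    show "colorable (wheel_vertices m) (wheel_edges m - {e}) 3" if "e \<in> wheel_edges m" for e
      using that
    proof (cases rule: wheel_edge_cases)
      case (1 i)
      then show ?thesis using colorable_wheel_minus_rim_edge assms by simp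
    next
      \<comment> \<open>In this and the following cases the three numbers colour
        \<open>wing1 i\<close>, \<open>wing2 i\<close> and \<open>tip i\<close>, while
        \<open>rim i\<close> and the hub have colour 0. They are chosen so that the deleted edge is
        the only one of this spoke with equal ends.\<close>
      case (2 i)
      show ?thesis
        by (rule colorable_wheel_minus_spoke_edge[OF assms 2(1), of 0 1 2]) (simp_all add: 2)
    next
      case (3 i)
      show ?thesis
        by (rule colorable_wheel_minus_spoke_edge[OF assms 3(1), of 1 0 2]) (simp_all add: 3)
    next
      case (4 i)
      show ?thesis
        by (rule colorable_wheel_minus_spoke_edge[OF assms 4(1), of 1 1 2]) (simp_all add: 4)
    next
      case (5 i)
      show ?thesis
        by (rule colorable_wheel_minus_spoke_edge[OF assms 5(1), of 1 2 1]) (simp_all add: 5)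
    next
      case (6 i)
      show ?thesis
        by (rule colorable_wheel_minus_spoke_edge[OF assms 6(1), of 1 2 2]) (simp_all add: 6)
    next
      case (7 i)
      show ?thesis
        by (rule colorable_wheel_minus_spoke_edge[OF assms 7(1), of 1 2 0]) (simp_all add: 7)
    qed
  qed
  then show ?thesis by simp
qed

section \<open>Chords of cycles in the wheels\<close>

text \<open>The wings and \<open>tip i\<close> are attached to the rest of the graph only through
  \<open>rim i\<close> and the edge from \<open>tip i\<close> to the hub. A cycle not using that
  edge cannot leave them once \<open>rim i\<close> is removed.\<close>

lemma wheel_cycle_through_diamond:
  assumes cyc: "is_cycle (wheel_vertices m) (wheel_edges m) vs"
    and meets: "set vs \<inter> {wing1 i, wing2 i, tip i} \<noteq> {}"
  shows "{hub, tip i} \<in> cycle_edges vs \<or> set vs \<subseteq> {rim i, wing1 i, wing2 i, tip i}"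
proof (rule disjCI)
  assume inside: "\<not> set vs \<subseteq> {rim i, wing1 i, wing2 i, tip i}"
  show "{hub, tip i} \<in> cycle_edges vs"
  proof (rule ccontr)
    assume no_hub: "{hub, tip i} \<notin> cycle_edges vs"
    let ?A = "{wing1 i, wing2 i, tip i}"
    obtain a where "a \<in> set vs" "a \<in> ?A" "a \<noteq> rim i"
      using meets by auto
    moreover have "v \<in> ?A"
      if uv: "{u, v} \<in> cycle_edges vs" and "u \<noteq> rim i" "v \<noteq> rim i" "u \<in> ?A" for u v
    proof -
      have "{u, v} \<in> wheel_edges m" using uv cyc unfolding is_cycle_def by blast
      then show ?thesis
        using that no_hub
        by (cases rule: wheel_edge_cases) (auto simp: doubleton_eq_iff insert_commute)
    qed
    moreover have "distinct vs" using cyc unfolding is_cycle_def by blast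
    ultimately have "set vs \<subseteq> insert (rim i) ?A"
      by (intro cycle_minus_vertex_connected[where a = a])
    then show False using inside by auto
  qed
qed

text \<open>An edge at a wing or a tip lies in a diamond that the cycle meets, or joins it to the
  hub. For a rim edge, an end whose diamond is otherwise avoided has only its two rim neighbours
  left, so the cycle uses both rim edges there and neither is a chord.\<close>

lemma chords_wheel_cycle:
  assumes cyc: "is_cycle (wheel_vertices m) (wheel_edges m) vs"
  shows "chords (wheel_edges m) vs \<subseteq> Pow (insert hub
    (\<Union>i\<in>{i. set vs \<inter> {wing1 i, wing2 i, tip i} \<noteq> {}}. {rim i, wing1 i, wing2 i, tip i}))"
    (is "_ \<subseteq> Pow (insert hub (\<Union>i\<in>?B. _))")
proof
  have vs: "3 \<le> length vs" "distinct vs" "cycle_edges vs \<subseteq> wheel_edges m"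
    using cyc unfolding is_cycle_def by auto
  have rim_edges: "{rim i, rim (Suc i mod m)} \<in> cycle_edges vs \<and>
      (\<forall>j<m. i = Suc j mod m \<longrightarrow> {rim i, rim j} \<in> cycle_edges vs)"
    if i: "rim i \<in> set vs" "i \<notin> ?B" for i
  proof -
    \<comment> \<open>A rim vertex has just one predecessor, so two distinct cycle neighbours on the
      rim must be its successor and its predecessor.\<close>
    have unique: "j = j'" if "j < m" "j' < m" "Suc j mod m = Suc j' mod m" for j j'
      using that by (auto simp: mod_Suc split: if_splits)
    have nb: "v = rim (Suc i mod m) \<or> (\<exists>j<m. i = Suc j mod m \<and> v = rim j)"
      if v: "v \<in> set vs" "{rim i, v} \<in> cycle_edges vs" for v
    proof -
      have "{rim i, v} \<in> wheel_edges m" using v vs by blast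
      then show ?thesis
        using i v by (cases rule: wheel_edge_cases) (auto simp: doubleton_eq_iff)
    qed
    obtain v w where vw: "v \<noteq> w" "v \<in> set vs" "w \<in> set vs"
      "{rim i, v} \<in> cycle_edges vs" "{rim i, w} \<in> cycle_edges vs"
      using cycle_neighbours_exist[OF vs(1,2) i(1)] by metis
    show ?thesis
      using nb[OF vw(2,4)] nb[OF vw(3,5)] vw unique by metis
  qed
  fix e assume "e \<in> chords (wheel_edges m) vs"
  then have e: "e \<in> wheel_edges m" "e \<subseteq> set vs" "e \<notin> cycle_edges vs"
    unfolding chords_def by auto
  from e(1) show "e \<in> Pow (insert hub (\<Union>i\<in>?B. {rim i, wing1 i, wing2 i, tip i}))"
  proof (cases rule: wheel_edge_cases)
    case (1 i)
    then have "i \<in> ?B" "Suc i mod m \<in> ?B"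
      using rim_edges[of i] rim_edges[of "Suc i mod m"] e(2,3) by (auto simp: insert_commute)
    then show ?thesis using 1 by blast
  qed (use e(2) in auto)
qed

text \<open>The chords are subsets of a set of at most \<open>1 + 2 * 4\<close> vertices; counting
  all its subsets is crude, but any bound independent of \<open>m\<close> suffices.\<close>

lemma card_chords_wheel_cycle:
  assumes cyc: "is_cycle (wheel_vertices m) (wheel_edges m) vs"
  shows "card (chords (wheel_edges m) vs) \<le> 2 ^ 9"
proof -
  let ?D = "\<lambda>i. {rim i, wing1 i, wing2 i, tip i}"
  define B where "B = {i. set vs \<inter> {wing1 i, wing2 i, tip i} \<noteq> {}}"
  have "distinct vs" using cyc unfolding is_cycle_def by blast
  have B: "finite B \<and> card B \<le> 2"
  proof (cases "\<exists>i. set vs \<subseteq> ?D i")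
    case True
    then obtain i where "set vs \<subseteq> ?D i" by blast
    then have "B \<subseteq> {i}" unfolding B_def by auto
    then show ?thesis
      using card_mono[of "{i}" B] finite_subset[of B "{i}"] by simp
  next
    case False
    let ?N = "{v. {hub, v} \<in> cycle_edges vs}"
    \<comment> \<open>Since the cycle stays in no single diamond, every diamond it enters accounts
      for its own cycle edge at the hub.\<close>
    have "tip ` B \<subseteq> ?N"
      using wheel_cycle_through_diamond[OF cyc] False unfolding B_def by blast
    moreover have "inj_on tip B"
      by (simp add: inj_on_def)
    ultimately have "finite B" "card B \<le> card ?N"
      using card_cycle_edge_neighbours(1)[OF \<open>distinct vs\<close>, of hub]
      by (auto intro: inj_on_finite card_inj_on_le)
    then show ?thesis
      using card_cycle_edge_neighbours(2)[OF \<open>distinct vs\<close>, of hub] by simp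
  qed
  let ?U = "insert hub (\<Union>i\<in>B. ?D i)"
  have "card (\<Union>i\<in>B. ?D i) \<le> (\<Sum>i\<in>B. card (?D i))"
    using B by (intro card_UN_le) simp
  also have "\<dots> \<le> (\<Sum>i\<in>B. 4)"
    by (intro sum_mono) simp
  also have "\<dots> \<le> 8"
    using B by simp
  finally have "card ?U \<le> 9"
    using B by (simp add: card_insert_if)
  have "card (chords (wheel_edges m) vs) \<le> card (Pow ?U)"
    using chords_wheel_cycle[OF cyc] B unfolding B_def by (intro card_mono) auto
  also have "\<dots> = 2 ^ card ?U"
    using B by (intro card_Pow) auto
  also have "\<dots> \<le> 2 ^ 9"
    using \<open>card ?U \<le> 9\<close> by (intro power_increasing) auto
  finally show ?thesis .
qed

section \<open>Bounded values of \<open>g 4\<close>\<close>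

lemma g_4_bounded:
  assumes "odd m" "2 \<le> m"
  shows "g 4 (4 * m + 1) \<le> enat (2 ^ 9)"
  unfolding g_def
proof (rule SUP_least)
  fix a assume "a \<in> {a. all_critical_have 4 (4 * m + 1) a}"
  then obtain vs where "is_cycle (wheel_vertices m) (wheel_edges m) vs"
    "a \<le> card (chords (wheel_edges m) vs)"
    using critical_wheel[OF assms] card_wheel_vertices unfolding all_critical_have_def by blast
  then show "enat a \<le> enat (2 ^ 9)"
    using card_chords_wheel_cycle by (simp only: enat_ord_simps) (meson order_trans)
qed

text \<open>The case \<open>k = 4\<close> refutes the claim: \<open>g 4\<close> stays bounded at the
  infinitely many orders \<open>4 * m + 1\<close> with \<open>m\<close> odd, so its values at other
  orders, possibly infinite, do not matter.\<close>

theorem corollary3p9: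
  shows "\<not> (\<forall>k\<ge>4. (g k \<longlongrightarrow> \<infinity>) sequentially)"
proof
  assume "\<forall>k\<ge>4. (g k \<longlongrightarrow> \<infinity>) sequentially"
  then have "(g 4 \<longlongrightarrow> \<infinity>) sequentially" by simp
  then have "\<forall>\<^sub>F n in sequentially. enat (2 ^ 9) < g 4 n"
    by (rule order_tendstoD) simp
  then obtain N where "\<And>n. N \<le> n \<Longrightarrow> enat (2 ^ 9) < g 4 n"
    unfolding eventually_sequentially by blast
  \<comment> \<open>\<open>2 * N + 3\<close> is odd and at least 2, and the resulting order exceeds
    \<open>N\<close>.\<close>
  moreover have "g 4 (4 * (2 * N + 3) + 1) \<le> enat (2 ^ 9)"
    by (rule g_4_bounded) simp_all
  ultimately show False
    by (simp add: linorder_not_less[symmetric])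
qed

end
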